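(* Let $(S_\xi)_{\xi\in\Xi}$ be a nondegenerate family of balls in $\mathbb{R}^N$, and let $S\in\mathscr{V}_NS$, $S\neq\{0\}$. Then $S$ belongs to $\pi^{\uparrow}(\Xi)$ if and only if for every $n\ge 1$ and every collection of vectors $x_1,\dots,x_n\in\mathbb{R}^N$ that are not all zero, $$ \frac{S}{\sum_{k=1}^{n}\|x_k\|_{S^\circ}}\ \le\ \bigvee_{\xi\in\Xi}\frac{S_\xi}{\sum_{k=1}^{n}\|x_k\|_{S_\xi^\circ}}. $$
   Context: $\mathscr{V}_N$ is the set of all nonempty compact convex subsets (convex figures) of $\mathbb{R}^N$. A figure $S$ is identified with its support function $S(z)=\sup\{(x,z): x\in S\}$, $z\in\mathbb{R}^N$, where $(\cdot,\cdot)$ is the standard inner product; thus $\mathscr{V}_N$ is a cone (with Minkowski addition and multiplication by nonnegative scalars $tS=\{ts:s\in S\}$) in the space $C(S_{N-1})$ of continuous functions on the Euclidean unit sphere $S_{N-1}$. The order $\le$ is inclusion (equivalently, the pointwise order of support functions); the join $\bigvee$ is the closed convex hull of the union (its support function is the pointwise supremum), and the meet $\bigwedge$ is intersection. Closedness refers to the Hausdorff metric, i.e. the Chebyshev norm of support functions on $S_{N-1}$. A ball is a symmetric ($S=-S$) absorbing member of $\mathscr{V}_N$. $\mathscr{V}_NS$ is the set of all balls in $\mathbb{R}^N$ together with $\{0\}$; its members are called gauges. For a ball $S$, $\|x\|_S=\inf\{\alpha>0: x/\alpha\in S\}$ for $x\in\mathbb{R}^N$, and $\|A\|_S=\sup\{\|Ax\|_S: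 x\in S\}$ for a linear endomorphism $A$ of $\mathbb{R}^N$. The polar is $S^\circ=\{x\in\mathbb{R}^N: |(x,y)|\le 1 \text{ for all } y\in S\}$; one has $\|\cdot\|_{S^\circ}=S(\cdot)$. A family $(S_\xi)_{\xi\in\Xi}$ of balls (nonzero members of $\mathscr{V}_NS$) is nondegenerate if $\sup_{\xi\in\Xi}\|A\|_{S_\xi}<+\infty$ for every linear endomorphism $A$ of $\mathbb{R}^N$. For a nondegenerate family, the upper hull $\pi^{\uparrow}(\Xi)$ is the least closed cone that lies in $\mathscr{V}_NS$, contains $S_\xi$ for all $\xi\in\Xi$, and is closed under the binary join $\vee$ of $\mathscr{V}_N$. *)

theory Defs
  imports "HOL-Analysis.Analysis"
begin

text \<open>Minkowski addition of sets is \<^term>\<open>A + B\<close> from \<^theory>\<open>HOL-Library.Set_Algebras\<close>,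
  and the dilate of \<open>A\<close> by \<open>t\<close> is \<^term>\<open>(*\<^sub>R) t ` A\<close>.\<close>

definition figures :: "(real ^ 'n) set set"
  where "figures = {S. S \<noteq> {} \<and> compact S \<and> convex S}"

definition support_fun :: "(real ^ 'n) set \<Rightarrow> real ^ 'n \<Rightarrow> real"
  where "support_fun S z = (SUP x\<in>S. x \<bullet> z)"

text \<open>The Hausdorff metric on figures, as the Chebyshev distance of the support functions on the
  Euclidean unit sphere. The value off the figures is a dummy: \<^locale>\<open>Metric_space\<close> requires the
  distance to be nonnegative on the whole type.\<close>

definition figure_dist :: "(real ^ 'n) set \<Rightarrow> (real ^ 'n) set \<Rightarrow> real"
  where "figure_dist S T =
    (if S \<in> figures \<and> T \<in> figures
     then SUP z\<in>sphere 0 1. \<bar>support_fun S z - support_fun T z\<bar> else 0)"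

lemma support_fun_upper:
  assumes "S \<in> figures" "x \<in> S"
  shows "x \<bullet> z \<le> support_fun S z"
proof -
  have "compact ((\<lambda>x. x \<bullet> z) ` S)"
    using assms by (intro compact_continuous_image continuous_intros) (auto simp: figures_def)
  then show ?thesis
    unfolding support_fun_def
    using assms by (intro cSUP_upper bounded_imp_bdd_above compact_imp_bounded)
qed

lemma support_fun_scaleR:
  assumes "S \<in> figures" "0 < c"
  shows "support_fun S (c *\<^sub>R z) = c * support_fun S z"
proof (rule antisym)
  have ne: "S \<noteq> {}" using assms by (auto simp: figures_def)
  show "support_fun S (c *\<^sub>R z) \<le> c * support_fun S z"
    unfolding support_fun_def[of S "c *\<^sub>R z"]
    using ne assms by (intro cSUP_least) (auto intro: support_fun_upper)
  have "x \<bullet> z \<le> support_fun S (c *\<^sub>R z) / c" if "x \<in> S" for x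
    using support_fun_upper[OF assms(1) that, of "c *\<^sub>R z"] assms(2) by (simp add: field_simps)
  then have "support_fun S z \<le> support_fun S (c *\<^sub>R z) / c"
    unfolding support_fun_def[of S z] using ne by (intro cSUP_least)
  then show "c * support_fun S z \<le> support_fun S (c *\<^sub>R z)"
    using assms(2) by (simp add: field_simps)
qed

lemma support_fun_subset:
  assumes S: "S \<in> figures" and T: "T \<in> figures"
    and le: "\<And>z. norm z = 1 \<Longrightarrow> support_fun S z \<le> support_fun T z"
  shows "S \<subseteq> T"
proof
  fix x assume x: "x \<in> S"
  show "x \<in> T"
  proof (rule ccontr)
    assume "x \<notin> T"
    moreover have cT: "convex T" "closed T" "T \<noteq> {}"
      using T by (auto simp: figures_def compact_imp_closed)
    ultimately obtain a b where ab: "a \<bullet> x < b" "\<And>y. y \<in> T \<Longrightarrow> b < a \<bullet> y"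
      using separating_hyperplane_closed_point[of T x] by metis
    have "a \<noteq> 0" using ab cT by fastforce
    define z where "z = (1 / norm a) *\<^sub>R (- a)"
    have n: "norm z = 1" using \<open>a \<noteq> 0\<close> by (simp add: z_def)
    have mz: "- a = norm a *\<^sub>R z" using \<open>a \<noteq> 0\<close> by (simp add: z_def)
    have "support_fun T (- a) \<le> - b"
      unfolding support_fun_def using cT ab(2)
      by (intro cSUP_least) (auto simp: inner_commute less_imp_le)
    also have "- b < x \<bullet> (- a)" using ab(1) by (simp add: inner_commute)
    also have "\<dots> \<le> support_fun S (- a)" by (rule support_fun_upper[OF S x])
    finally show False
      using le[OF n] \<open>a \<noteq> 0\<close> unfolding mz
      by (simp add: support_fun_scaleR[OF S] support_fun_scaleR[OF T])
  qed
qed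

lemma support_fun_bounded:
  assumes S: "S \<in> figures"
  obtains B where "\<And>z. norm z = 1 \<Longrightarrow> \<bar>support_fun S z\<bar> \<le> B"
proof -
  have ne: "S \<noteq> {}" and "bounded S" using S by (auto simp: figures_def compact_imp_bounded)
  then obtain B where B: "\<And>x. x \<in> S \<Longrightarrow> norm x \<le> B" by (auto simp: bounded_iff)
  have "\<bar>support_fun S z\<bar> \<le> B" if z: "norm z = 1" for z
  proof -
    have *: "\<bar>x \<bullet> z\<bar> \<le> B" if "x \<in> S" for x
      using Cauchy_Schwarz_ineq2[of x z] B[OF that] z by simp
    have "support_fun S z \<le> B"
      unfolding support_fun_def using ne *
      by (intro cSUP_least) (auto simp: abs_le_iff)
    moreover obtain x where "x \<in> S" using ne by blast
    ultimately show ?thesis using * [of x] support_fun_upper[OF S, of x z] by linarith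
  qed
  then show thesis using that by blast
qed

lemma figure_dist_upper:
  assumes S: "S \<in> figures" and T: "T \<in> figures" and z: "norm z = 1"
  shows "\<bar>support_fun S z - support_fun T z\<bar> \<le> figure_dist S T"
proof -
  obtain B where B: "\<And>z. norm z = 1 \<Longrightarrow> \<bar>support_fun S z\<bar> \<le> B"
    using support_fun_bounded[OF S] by blast
  obtain C where C: "\<And>z. norm z = 1 \<Longrightarrow> \<bar>support_fun T z\<bar> \<le> C"
    using support_fun_bounded[OF T] by blast
  have "\<bar>support_fun S z - support_fun T z\<bar> \<le> B + C" if "norm z = 1" for z
    using B[OF that] C[OF that] by linarith
  then have "bdd_above ((\<lambda>z. \<bar>support_fun S z - support_fun T z\<bar>) ` sphere 0 1)"
    by (intro bdd_aboveI2[where M = "B + C"]) simp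
  then show ?thesis
    using S T z by (auto simp: figure_dist_def intro: cSUP_upper)
qed

lemma figure_dist_least:
  assumes "S \<in> figures" "T \<in> figures"
    and "\<And>z. norm z = 1 \<Longrightarrow> \<bar>support_fun S z - support_fun T z\<bar> \<le> c"
  shows "figure_dist S T \<le> c"
  using assms by (auto simp: figure_dist_def intro!: cSUP_least)

lemma Metric_space_figures: "Metric_space figures (figure_dist :: (real ^ 'n) set \<Rightarrow> _)"
proof
  obtain u :: "real ^ 'n" where u: "norm u = 1"
    using vector_choose_size[of 1] by auto
  fix S T U :: "(real ^ 'n) set"
  show "0 \<le> figure_dist S T"
  proof (cases "S \<in> figures \<and> T \<in> figures")
    case True
    then show ?thesis using figure_dist_upper[of S T u] u by linarith
  qed (auto simp: figure_dist_def)
  show "figure_dist S T = figure_dist T S"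
    by (auto simp: figure_dist_def abs_minus_commute)
  assume S: "S \<in> figures" and T: "T \<in> figures"
  show "figure_dist S T = 0 \<longleftrightarrow> S = T"
  proof
    assume "figure_dist S T = 0"
    then have "support_fun S z = support_fun T z" if "norm z = 1" for z
      using figure_dist_upper[OF S T that] by simp
    then show "S = T"
      using support_fun_subset[OF S T] support_fun_subset[OF T S] by auto
  next
    assume "S = T"
    have "figure_dist S S \<le> 0" using S by (intro figure_dist_least) auto
    moreover have "0 \<le> figure_dist S S" using figure_dist_upper[OF S S u] by simp
    ultimately show "figure_dist S T = 0" using \<open>S = T\<close> by simp
  qed
  assume U: "U \<in> figures"
  show "figure_dist S U \<le> figure_dist S T + figure_dist T U"
    using S U
  proof (rule figure_dist_least)
    fix z :: "real ^ 'n" assume "norm z = 1"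
    then show "\<bar>support_fun S z - support_fun U z\<bar> \<le> figure_dist S T + figure_dist T U"
      using figure_dist_upper[OF S T, of z] figure_dist_upper[OF T U, of z] by linarith
  qed
qed

abbreviation figure_topology :: "(real ^ 'n) set topology"
  where "figure_topology \<equiv> Metric_space.mtopology figures figure_dist"

text \<open>The join of a family of figures with bounded union; its order is inclusion.\<close>

definition figure_Join :: "(real ^ 'n) set set \<Rightarrow> (real ^ 'n) set"
  where "figure_Join \<A> = closure (convex hull (\<Union>\<A>))"

definition absorbing :: "(real ^ 'n) set \<Rightarrow> bool"
  where "absorbing S \<longleftrightarrow> (\<forall>x. \<exists>r>0. \<forall>t. r \<le> \<bar>t\<bar> \<longrightarrow> x \<in> (*\<^sub>R) t ` S)"

definition figure_balls :: "(real ^ 'n) set set"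
  where "figure_balls = {S \<in> figures. S = uminus ` S \<and> absorbing S}"

definition gauges :: "(real ^ 'n) set set"
  where "gauges = insert {0} figure_balls"

definition gauge_norm :: "(real ^ 'n) set \<Rightarrow> real ^ 'n \<Rightarrow> real"
  where "gauge_norm S x = Inf {\<alpha>. \<alpha> > 0 \<and> x /\<^sub>R \<alpha> \<in> S}"

definition endo_norm :: "(real ^ 'n) set \<Rightarrow> (real ^ 'n \<Rightarrow> real ^ 'n) \<Rightarrow> real"
  where "endo_norm S A = (SUP x\<in>S. gauge_norm S (A x))"

definition polar :: "(real ^ 'n) set \<Rightarrow> (real ^ 'n) set"
  where "polar S = {x. \<forall>y\<in>S. \<bar>x \<bullet> y\<bar> \<le> 1}"

definition nondegenerate :: "'i set \<Rightarrow> ('i \<Rightarrow> (real ^ 'n) set) \<Rightarrow> bool"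
  where "nondegenerate \<Xi> S \<longleftrightarrow>
    (\<forall>\<xi>\<in>\<Xi>. S \<xi> \<in> figure_balls) \<and>
    (\<forall>A. linear A \<longrightarrow> bdd_above ((\<lambda>\<xi>. endo_norm (S \<xi>) A) ` \<Xi>))"

text \<open>Closedness is in the space of all figures, so a closed upper cone of gauges contains no
  sequence of balls converging to a nonzero figure that is not absorbing.\<close>

definition closed_upper_cone :: "(real ^ 'n) set set \<Rightarrow> bool"
  where "closed_upper_cone K \<longleftrightarrow>
    K \<subseteq> gauges \<and> K \<noteq> {} \<and>
    (\<forall>A\<in>K. \<forall>B\<in>K. A + B \<in> K) \<and>
    (\<forall>A\<in>K. \<forall>t\<ge>0. (*\<^sub>R) t ` A \<in> K) \<and>
    (\<forall>A\<in>K. \<forall>B\<in>K. figure_Join {A, B} \<in> K) \<and>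
    closedin figure_topology K"

text \<open>\<^const>\<open>hull\<close> is the intersection of all closed upper cones that contain the family. It is
  itself such a cone whenever there is at least one, which nondegeneracy of the family guarantees:
  a uniform bound on rank-one endomorphisms keeps limits of the generated balls absorbing or zero.\<close>

definition upper_hull :: "'i set \<Rightarrow> ('i \<Rightarrow> (real ^ 'n) set) \<Rightarrow> (real ^ 'n) set set"
  where "upper_hull \<Xi> S = closed_upper_cone hull (S ` \<Xi>)"

end

theory Submission
  imports Defs
begin

text \<open>By positive homogeneity the stated inclusions say that every inequality
  \<open>h(y) \<le> h(x\<^sub>1) + \<dots> + h(x\<^sub>n)\<close> valid for the support functions of all members of the family is
  valid for that of \<open>S\<close>. Such inequalities survive sums, dilates, joins and limits, so they hold on
  the hull. Conversely, let \<open>K\<close> be a closed upper cone containing the family. Given finitely many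
  unit vectors and one more vector \<open>y\<close>, a theorem of the alternative yields either a member of \<open>K\<close>
  whose support function is nearly below that of \<open>S\<close> at all the vectors and nearly above it at \<open>y\<close>,
  or an inequality of the above form that fails for \<open>S\<close>. Letting \<open>y\<close> run through the vectors and
  joining gives a member of \<open>K\<close> close to \<open>S\<close> on a finite net of the sphere; such a member satisfies
  an a priori Lipschitz bound, so it is close to \<open>S\<close> on the whole sphere.\<close>

section \<open>Theorem of the alternative\<close>

text \<open>The induction merges the weighted sum over \<open>I\<close> and the new coordinate into a point of the
  plane, where the convex image is separated from the open negative quadrant.\<close>

lemma convex_alternative:
  fixes C :: "('a \<Rightarrow> real) set"
  assumes "finite I" "C \<noteq> {}"
    and "\<And>g h t. \<lbrakk>g \<in> C; h \<in> C; 0 \<le> t; t \<le> 1\<rbrakk> \<Longrightarrow> (\<lambda>i. (1 - t) * g i + t * h i) \<in> C"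
    and "\<And>g. g \<in> C \<Longrightarrow> \<exists>i\<in>I. 0 \<le> g i"
  shows "\<exists>w. (\<forall>i\<in>I. 0 \<le> w i) \<and> (\<exists>i\<in>I. 0 < w i) \<and> (\<forall>g\<in>C. 0 \<le> (\<Sum>i\<in>I. w i * g i))"
  using assms
proof (induction I arbitrary: C rule: finite_induct)
  case empty
  then show ?case by blast
next
  case (insert j I)
  note conv = insert.prems(2)
  \<comment> \<open>Members that are negative at \<open>j\<close> must be nonnegative somewhere in
    \<open>I\<close>, so the induction hypothesis applies to them and gives weights on
    \<open>I\<close>.\<close>
  define C' where "C' = {g \<in> C. g j < 0}"
  show ?case
  proof (cases "C' = {}")
    case True
    then have "0 \<le> g j" if "g \<in> C" for g using that by (force simp: C'_def)
    then have "0 \<le> (\<Sum>i\<in>insert j I. (if i = j then 1 else 0) * g i)" if "g \<in> C" for g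
      using that insert.hyps by (simp add: if_distrib[of "\<lambda>x. x * _"] cong: if_cong)
    then show ?thesis by (intro exI[of _ "\<lambda>i. if i = j then 1 else 0"]) auto
  next
    case False
    have "\<exists>w. (\<forall>i\<in>I. 0 \<le> w i) \<and> (\<exists>i\<in>I. 0 < w i) \<and> (\<forall>g\<in>C'. 0 \<le> (\<Sum>i\<in>I. w i * g i))"
    proof (rule insert.IH[OF False])
      fix g h and t :: real assume "g \<in> C'" "h \<in> C'" "0 \<le> t" "t \<le> 1"
      moreover from this have "(1 - t) * g j + t * h j < 0"
        by (intro convex_bound_lt) (auto simp: C'_def)
      ultimately show "(\<lambda>i. (1 - t) * g i + t * h i) \<in> C'"
        using conv by (auto simp: C'_def)
    next
      fix g assume "g \<in> C'"
      then show "\<exists>i\<in>I. 0 \<le> g i" using insert.prems(3)[of g] by (force simp: C'_def)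
    qed
    then obtain w where w: "\<And>i. i \<in> I \<Longrightarrow> 0 \<le> w i" "\<exists>i\<in>I. 0 < w i"
      "\<And>g. g \<in> C' \<Longrightarrow> 0 \<le> (\<Sum>i\<in>I. w i * g i)" by blast
    define \<phi> where "\<phi> = (\<lambda>g. \<Sum>i\<in>I. w i * g i)"
    define D where "D = (\<lambda>g. (\<phi> g, g j)) ` C"
    define Q where "Q = {..<0::real} \<times> {..<0::real}"
    have "convex D"
    proof (rule convexI)
      fix x y and u v :: real
      assume xy: "x \<in> D" "y \<in> D" and uv: "0 \<le> u" "0 \<le> v" "u + v = 1"
      from xy obtain g h where gh: "g \<in> C" "h \<in> C" "x = (\<phi> g, g j)" "y = (\<phi> h, h j)"
        by (auto simp: D_def)
      define k where "k = (\<lambda>i. (1 - v) * g i + v * h i)"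
      have "k \<in> C" unfolding k_def using gh uv by (intro conv) auto
      moreover have "u *\<^sub>R x + v *\<^sub>R y = (\<phi> k, k j)"
      proof -
        have u: "u = 1 - v" using uv by simp
        show ?thesis unfolding gh k_def \<phi>_def u
          by (simp add: sum_distrib_left sum.distrib[symmetric] algebra_simps)
      qed
      ultimately show "u *\<^sub>R x + v *\<^sub>R y \<in> D" by (auto simp: D_def)
    qed
    moreover have "convex Q" unfolding Q_def by (intro convex_Times convex_real_interval)
    moreover have "Q \<noteq> {}" by (auto simp: Q_def intro: exI[of _ "-1"])
    moreover have "D \<noteq> {}" using insert.prems(1) by (auto simp: D_def)
    \<comment> \<open>A member with both coordinates negative would lie in \<open>C'\<close>, where
      the weighted sum is nonnegative.\<close>
    moreover have "Q \<inter> D = {}"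
      using w(3) by (force simp: Q_def D_def C'_def \<phi>_def)
    ultimately obtain a b where a: "a \<noteq> 0" "\<And>x. x \<in> Q \<Longrightarrow> a \<bullet> x \<le> b" "\<And>x. x \<in> D \<Longrightarrow> b \<le> a \<bullet> x"
      using separating_hyperplane_sets[of Q D] by metis
    obtain p q where pq: "a = (p, q)" by (cases a)
    have Q: "p * s + q * t \<le> b" if "s < 0" "t < 0" for s t
      using a(2)[of "(s, t)"] that by (simp add: Q_def pq)
    have "0 \<le> p"
    proof (rule ccontr)
      assume "\<not> 0 \<le> p"
      \<comment> \<open>The point of \<open>Q\<close> with this first coordinate and second
        coordinate \<open>- 1\<close> has the value |b| + |q| + 1 - q, which exceeds
        \<open>b\<close>.\<close>
      then have "(\<bar>b\<bar> + \<bar>q\<bar> + 1) / p < 0" by (simp add: divide_less_0_iff)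
      then show False using Q[of "(\<bar>b\<bar> + \<bar>q\<bar> + 1) / p" "- 1"] \<open>\<not> 0 \<le> p\<close>
        by (auto simp: divide_less_0_iff)
    qed
    have "0 \<le> q"
    proof (rule ccontr)
      assume "\<not> 0 \<le> q"
      then have "(\<bar>b\<bar> + \<bar>p\<bar> + 1) / q < 0" by (simp add: divide_less_0_iff)
      then show False using Q[of "- 1" "(\<bar>b\<bar> + \<bar>p\<bar> + 1) / q"] \<open>\<not> 0 \<le> q\<close>
        by (auto simp: divide_less_0_iff)
    qed
    have pos: "0 < p \<or> 0 < q" using a(1) \<open>0 \<le> p\<close> \<open>0 \<le> q\<close> by (auto simp: pq zero_prod_def)
    have "0 \<le> b"
    proof (rule ccontr)
      assume b: "\<not> 0 \<le> b"
      have s: "0 < p + q" using pos \<open>0 \<le> p\<close> \<open>0 \<le> q\<close> by linarith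
      \<comment> \<open>If \<open>b\<close> is negative, this diagonal point of \<open>Q\<close> has
        the value \<open>b / 2\<close>, which lies above \<open>b\<close>.\<close>
      define e where "e = (b / 2) / (p + q)"
      have "e < 0" using b s by (simp add: e_def divide_less_0_iff)
      moreover have "e * (p + q) = b / 2"
        using nonzero_eq_divide_eq[of "p + q" e "b / 2"] s e_def by simp
      ultimately show False using Q[of e e] b by (simp add: algebra_simps)
    qed
    have fin: "0 \<le> p * \<phi> g + q * g j" if "g \<in> C" for g
      using a(3)[of "(\<phi> g, g j)"] that \<open>0 \<le> b\<close> by (auto simp: D_def pq)
    define v where "v = (\<lambda>i. if i = j then q else p * w i)"
    have "(\<Sum>i\<in>insert j I. v i * g i) = p * \<phi> g + q * g j" for g
    proof -
      have "(\<Sum>i\<in>I. v i * g i) = p * \<phi> g"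
        unfolding \<phi>_def sum_distrib_left
        using insert.hyps by (intro sum.cong) (auto simp: v_def)
      then show ?thesis using insert.hyps by (simp add: v_def)
    qed
    moreover have "\<forall>i\<in>insert j I. 0 \<le> v i"
      using w(1) \<open>0 \<le> p\<close> \<open>0 \<le> q\<close> by (auto simp: v_def)
    moreover have "\<exists>i\<in>insert j I. 0 < v i"
    proof (cases "0 < q")
      case True
      then show ?thesis by (auto simp: v_def)
    next
      case False
      then have "0 < p" using pos by blast
      moreover obtain i where "i \<in> I" "0 < w i" using w(2) by blast
      ultimately show ?thesis using insert.hyps by (intro bexI[of _ i]) (auto simp: v_def)
    qed
    ultimately show ?thesis using fin by (intro exI[of _ v]) auto
  qed
qed

section \<open>Support functions of sums, dilates and joins\<close>

lemma support_fun_least: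
  assumes "S \<noteq> {}" "\<And>x. x \<in> S \<Longrightarrow> x \<bullet> z \<le> c"
  shows "support_fun S z \<le> c"
  unfolding support_fun_def using assms by (intro cSUP_least)

lemma support_fun_eqI:
  assumes "S \<in> figures" "\<And>x. x \<in> S \<Longrightarrow> x \<bullet> z \<le> c" "\<exists>x\<in>S. x \<bullet> z = c"
  shows "support_fun S z = c"
proof (rule antisym)
  show "support_fun S z \<le> c" using assms by (intro support_fun_least) auto
  show "c \<le> support_fun S z" using assms support_fun_upper by blast
qed

lemma support_fun_attained:
  assumes "S \<in> figures"
  obtains x where "x \<in> S" "support_fun S z = x \<bullet> z"
proof -
  have "continuous_on S (\<lambda>x. x \<bullet> z)" by (intro continuous_intros)
  then obtain x where "x \<in> S" "\<And>y. y \<in> S \<Longrightarrow> y \<bullet> z \<le> x \<bullet> z"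
    using assms continuous_attains_sup[of S "\<lambda>x. x \<bullet> z"] by (auto simp: figures_def)
  then show thesis using that support_fun_eqI[OF assms, of z "x \<bullet> z"] by blast
qed

lemma support_fun_0: "S \<in> figures \<Longrightarrow> support_fun S 0 = 0"
  by (intro support_fun_eqI) (auto simp: figures_def)

lemma support_fun_scaleR_nonneg:
  "\<lbrakk>S \<in> figures; 0 \<le> c\<rbrakk> \<Longrightarrow> support_fun S (c *\<^sub>R z) = c * support_fun S z"
  by (cases "c = 0") (auto simp: support_fun_0 support_fun_scaleR)

lemma support_fun_singleton_0 [simp]: "support_fun {0} z = 0"
  by (simp add: support_fun_def)

lemma figures_singleton_0: "{0} \<in> figures"
  by (simp add: figures_def)

lemma figures_plus:
  assumes "A \<in> figures" "B \<in> figures"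
  shows "A + B \<in> figures"
proof -
  have eq: "A + B = {x + y |x y. x \<in> A \<and> y \<in> B}" by (auto simp: set_plus_def)
  have "compact (A + B)" unfolding eq using assms by (intro compact_sums) (auto simp: figures_def)
  moreover have "convex (A + B)" using assms by (intro convex_set_plus) (auto simp: figures_def)
  moreover have "A + B \<noteq> {}" using assms unfolding eq figures_def by blast
  ultimately show ?thesis by (simp add: figures_def)
qed

lemma support_fun_plus:
  assumes "A \<in> figures" "B \<in> figures"
  shows "support_fun (A + B) z = support_fun A z + support_fun B z"
proof -
  obtain a where a: "a \<in> A" "support_fun A z = a \<bullet> z" by (rule support_fun_attained[OF assms(1)])
  obtain b where b: "b \<in> B" "support_fun B z = b \<bullet> z" by (rule support_fun_attained[OF assms(2)])
  show ?thesis
  proof (rule support_fun_eqI[OF figures_plus[OF assms]])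
    fix x assume "x \<in> A + B"
    then show "x \<bullet> z \<le> support_fun A z + support_fun B z"
      using assms by (auto simp: set_plus_def inner_add_left intro!: add_mono support_fun_upper)
  next
    show "\<exists>x\<in>A + B. x \<bullet> z = support_fun A z + support_fun B z"
      using a b by (intro bexI[of _ "a + b"]) (auto simp: inner_add_left)
  qed
qed

lemma figures_scaleR: "A \<in> figures \<Longrightarrow> (*\<^sub>R) t ` A \<in> figures"
  by (auto simp: figures_def compact_scaling convex_scaling)

lemma support_fun_dilate:
  assumes "A \<in> figures" "0 \<le> t"
  shows "support_fun ((*\<^sub>R) t ` A) z = t * support_fun A z"
proof -
  obtain a where a: "a \<in> A" "support_fun A z = a \<bullet> z" by (rule support_fun_attained[OF assms(1)])
  have "x \<bullet> z \<le> a \<bullet> z" if "x \<in> A" for x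
    using support_fun_upper[OF assms(1) that] a(2) by metis
  then show ?thesis
    using a assms by (intro support_fun_eqI figures_scaleR) (auto intro!: mult_left_mono)
qed

text \<open>The convex hull of a compact set is compact in finite dimension, so the closure in the
  join adds nothing.\<close>

lemma figure_Join_pair: "\<lbrakk>A \<in> figures; B \<in> figures\<rbrakk> \<Longrightarrow> figure_Join {A, B} = convex hull (A \<union> B)"
  by (auto simp: figure_Join_def figures_def compact_Un compact_convex_hull compact_imp_closed)

lemma figures_Join_pair: "\<lbrakk>A \<in> figures; B \<in> figures\<rbrakk> \<Longrightarrow> figure_Join {A, B} \<in> figures"
  using figure_Join_pair[of A B] by (auto simp: figures_def compact_Un compact_convex_hull)

lemma support_fun_Join_pair:
  assumes "A \<in> figures" "B \<in> figures"
  shows "support_fun (figure_Join {A, B}) z = max (support_fun A z) (support_fun B z)"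
    (is "_ = ?m")
proof (rule support_fun_eqI[OF figures_Join_pair[OF assms]])
  have "convex {x. x \<bullet> z \<le> ?m}" using convex_halfspace_le[of z] by (simp add: inner_commute)
  moreover have "A \<union> B \<subseteq> {x. x \<bullet> z \<le> ?m}"
    using support_fun_upper[OF assms(1), of _ z] support_fun_upper[OF assms(2), of _ z]
    by (auto simp: le_max_iff_disj)
  ultimately have "convex hull (A \<union> B) \<subseteq> {x. x \<bullet> z \<le> ?m}" by (intro hull_minimal)
  then show "x \<bullet> z \<le> ?m" if "x \<in> figure_Join {A, B}" for x
    using that unfolding figure_Join_pair[OF assms] by blast
  obtain a where "a \<in> A" "support_fun A z = a \<bullet> z" by (rule support_fun_attained[OF assms(1)])
  moreover obtain b where "b \<in> B" "support_fun B z = b \<bullet> z"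
    by (rule support_fun_attained[OF assms(2)])
  moreover have "A \<union> B \<subseteq> figure_Join {A, B}"
    unfolding figure_Join_pair[OF assms] by (rule hull_subset)
  ultimately show "\<exists>x\<in>figure_Join {A, B}. x \<bullet> z = ?m"
    by (cases "support_fun A z \<le> support_fun B z") (auto simp: max_def)
qed

section \<open>Lipschitz and norm estimates\<close>

text \<open>By Cauchy-Schwarz, any bound on the norms of the points of a figure is a Lipschitz
  constant of its support function.\<close>

lemma support_fun_lipschitz:
  assumes "A \<in> figures" "\<And>x. x \<in> A \<Longrightarrow> norm x \<le> B"
  shows "support_fun A z \<le> support_fun A w + B * norm (z - w)"
proof (rule support_fun_least)
  show "A \<noteq> {}" using assms by (auto simp: figures_def)
  fix x assume x: "x \<in> A"
  have "x \<bullet> z = x \<bullet> w + x \<bullet> (z - w)" by (simp add: inner_diff_right)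
  also have "x \<bullet> (z - w) \<le> norm x * norm (z - w)" by (rule norm_cauchy_schwarz)
  also have "\<dots> \<le> B * norm (z - w)" using assms(2)[OF x] by (intro mult_right_mono) auto
  finally show "x \<bullet> z \<le> support_fun A w + B * norm (z - w)"
    using support_fun_upper[OF assms(1) x, of w] by linarith
qed

text \<open>Bounds in the signed axis directions confine each coordinate, and the Euclidean norm is
  at most the sum of the absolute coordinates. Control in finitely many directions thus yields a
  Lipschitz constant.\<close>

lemma figure_norm_le:
  fixes A :: "(real ^ 'n) set"
  assumes "A \<in> figures"
    and "\<And>b. b \<in> Basis \<Longrightarrow> support_fun A b \<le> L" "\<And>b. b \<in> Basis \<Longrightarrow> support_fun A (- b) \<le> L"
    and "x \<in> A"
  shows "norm x \<le> real DIM(real ^ 'n) * L"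
proof -
  have "norm x \<le> (\<Sum>b\<in>Basis. \<bar>x \<bullet> b\<bar>)" by (rule norm_le_l1)
  also have "\<dots> \<le> (\<Sum>b\<in>(Basis :: (real ^ 'n) set). L :: real)"
  proof (rule sum_mono)
    fix b :: "real ^ 'n" assume "b \<in> Basis"
    then show "\<bar>x \<bullet> b\<bar> \<le> L"
      using support_fun_upper[OF assms(1,4), of b] support_fun_upper[OF assms(1,4), of "- b"]
        assms(2,3)[of b] by (simp add: abs_le_iff)
  qed
  finally show ?thesis by simp
qed

lemma continuous_support_fun:
  assumes "A \<in> figures"
  shows "continuous_on UNIV (support_fun A)"
proof -
  obtain B where B: "0 < B" "\<And>x. x \<in> A \<Longrightarrow> norm x \<le> B"
    using assms compact_imp_bounded[of A] unfolding figures_def bounded_pos by blast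
  have "dist (support_fun A z) (support_fun A w) \<le> B * dist z w" for z w
    using support_fun_lipschitz[OF assms B(2), of z w] support_fun_lipschitz[OF assms B(2), of w z]
    by (simp add: dist_norm norm_minus_commute abs_le_iff)
  then have "B-lipschitz_on UNIV (support_fun A)" using B(1) by (intro lipschitz_onI) auto
  then show ?thesis by (rule lipschitz_on_continuous_on)
qed

section \<open>Balls in terms of support functions\<close>

text \<open>The radius is the minimum of the support function over the unit sphere, which
  compactness makes attained and hence positive.\<close>

lemma figure_cball_subset:
  fixes A :: "(real ^ 'n) set"
  assumes A: "A \<in> figures" and pos: "\<And>z. z \<noteq> 0 \<Longrightarrow> 0 < support_fun A z"
  obtains r where "0 < r" "cball 0 r \<subseteq> A"
proof -
  have "sphere (0 :: real ^ 'n) 1 \<noteq> {}" by simp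
  then obtain u where u: "u \<in> sphere 0 1" "\<And>z. z \<in> sphere 0 1 \<Longrightarrow> support_fun A u \<le> support_fun A z"
    using continuous_attains_inf[of "sphere 0 1" "support_fun A"]
      continuous_on_subset[OF continuous_support_fun[OF A]] by (metis compact_sphere subset_UNIV)
  define r where "r = support_fun A u"
  have r: "0 < r" unfolding r_def using u(1) by (intro pos) auto
  have "cball 0 r \<subseteq> A"
  proof (rule support_fun_subset[OF _ A])
    show "cball 0 r \<in> figures" using r by (simp add: figures_def)
    fix z :: "real ^ 'n" assume z: "norm z = 1"
    have "support_fun (cball 0 r) z \<le> r"
    proof (rule support_fun_least)
      fix x :: "real ^ 'n" assume "x \<in> cball 0 r"
      then show "x \<bullet> z \<le> r" using norm_cauchy_schwarz[of x z] z by simp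
    qed (use r in auto)
    also have "r \<le> support_fun A z" unfolding r_def using z by (intro u(2)) simp
    finally show "support_fun (cball 0 r) z \<le> support_fun A z" .
  qed
  then show thesis using r that by blast
qed

text \<open>Negating a figure reflects the argument of its support function, and a figure is
  determined by its support function. Symmetry becomes a pointwise condition that is easy to carry
  through sums, joins and limits.\<close>

lemma symmetric_iff_support_fun:
  assumes A: "A \<in> figures"
  shows "A = uminus ` A \<longleftrightarrow> (\<forall>z. support_fun A (- z) = support_fun A z)"
proof -
  have f: "uminus ` A \<in> figures" using figures_scaleR[OF A, of "- 1"] by simp
  have h: "support_fun (uminus ` A) z = support_fun A (- z)" for z
    by (simp add: support_fun_def image_image)
  show ?thesis
  proof
    assume "A = uminus ` A"
    then show "\<forall>z. support_fun A (- z) = support_fun A z" using h by metis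
  next
    assume "\<forall>z. support_fun A (- z) = support_fun A z"
    then show "A = uminus ` A"
      using h by (intro subset_antisym support_fun_subset A f) simp_all
  qed
qed

lemma figure_ballsD:
  assumes "A \<in> figure_balls"
  shows "A \<in> figures" "A = uminus ` A" "absorbing A"
  using assms unfolding figure_balls_def by blast+

lemma figure_balls_support_fun_pos:
  assumes "A \<in> figure_balls" "z \<noteq> 0"
  shows "0 < support_fun A z"
proof -
  obtain r where r: "0 < r" "\<forall>t. r \<le> \<bar>t\<bar> \<longrightarrow> z \<in> (*\<^sub>R) t ` A"
    using figure_ballsD(3)[OF assms(1)] unfolding absorbing_def by blast
  have "z \<in> (*\<^sub>R) r ` A" using r(2) abs_ge_self by blast
  then obtain a where a: "a \<in> A" "z = r *\<^sub>R a" by blast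
  have "0 < a \<bullet> z" using a r(1) assms(2) by (simp add: zero_less_mult_iff)
  also have "\<dots> \<le> support_fun A z" using a figure_ballsD(1)[OF assms(1)] by (intro support_fun_upper)
  finally show ?thesis .
qed

lemma figure_balls_support_fun_nonneg: "A \<in> figure_balls \<Longrightarrow> 0 \<le> support_fun A z"
  using figure_balls_support_fun_pos[of A z] support_fun_0[of A] figure_ballsD(1)[of A]
  by (cases "z = 0") (auto intro: less_imp_le)

lemma figure_ballsI:
  assumes A: "A \<in> figures" "A = uminus ` A" and pos: "\<And>z. z \<noteq> 0 \<Longrightarrow> 0 < support_fun A z"
  shows "A \<in> figure_balls"
proof -
  obtain r where r: "0 < r" "cball 0 r \<subseteq> A" using figure_cball_subset[OF A(1) pos] by blast
  have "\<exists>s>0. \<forall>t. s \<le> \<bar>t\<bar> \<longrightarrow> x \<in> (*\<^sub>R) t ` A" for x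
  proof (intro exI[of _ "norm x / r + 1"] conjI allI impI)
    \<comment> \<open>Division by a \<open>t\<close> beyond this threshold brings \<open>x\<close>
      into the inscribed ball; the summand 1 keeps the threshold positive when
      \<open>x = 0\<close>.\<close>
    show "0 < norm x / r + 1" using r by (simp add: add_nonneg_pos)
    fix t assume t: "norm x / r + 1 \<le> \<bar>t\<bar>"
    have "norm x / r \<ge> 0" using r by simp
    with t have t0: "t \<noteq> 0" by auto
    have "norm x / r \<le> \<bar>t\<bar>" using t by linarith
    then have "norm (x /\<^sub>R t) \<le> r" using r t0 by (simp add: field_simps)
    then have "x /\<^sub>R t \<in> A" using r(2) by auto
    then show "x \<in> (*\<^sub>R) t ` A" using t0 by (intro image_eqI[of _ _ "x /\<^sub>R t"]) auto
  qed
  then show ?thesis using A unfolding figure_balls_def absorbing_def by blast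
qed

lemma gauges_subset_figures: "gauges \<subseteq> figures"
  using figure_ballsD(1) figures_singleton_0 unfolding gauges_def by blast

text \<open>By symmetry, \<open>x /\<^sub>R \<alpha>\<close> lies in the polar exactly when
  \<open>support_fun A x \<le> \<alpha>\<close>, for positive \<alpha>. The case
  \<open>x = 0\<close> stands apart because there the infimum 0 is not itself admissible.\<close>

lemma gauge_norm_polar:
  assumes A: "A \<in> figure_balls"
  shows "gauge_norm (polar A) x = support_fun A x"
proof -
  note A' = figure_ballsD[OF A]
  have ne: "A \<noteq> {}" using A'(1) by (auto simp: figures_def)
  have "x /\<^sub>R \<alpha> \<in> polar A \<longleftrightarrow> support_fun A x \<le> \<alpha>" if "\<alpha> > 0" for \<alpha>
  proof
    assume "x /\<^sub>R \<alpha> \<in> polar A"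
    then have "\<bar>y \<bullet> x\<bar> \<le> \<alpha>" if "y \<in> A" for y
      using that \<open>\<alpha> > 0\<close> by (auto simp: polar_def abs_mult field_simps inner_commute)
    then show "support_fun A x \<le> \<alpha>" using ne by (intro support_fun_least) (auto simp: abs_le_iff)
  next
    assume le: "support_fun A x \<le> \<alpha>"
    have sym: "support_fun A (- x) = support_fun A x"
      using symmetric_iff_support_fun[OF A'(1)] A'(2) by blast
    have "\<bar>x \<bullet> y\<bar> \<le> \<alpha>" if "y \<in> A" for y
      using support_fun_upper[OF A'(1) that, of x] support_fun_upper[OF A'(1) that, of "- x"] le sym
      by (simp add: abs_le_iff inner_commute)
    then show "x /\<^sub>R \<alpha> \<in> polar A"
      using \<open>\<alpha> > 0\<close> by (auto simp: polar_def abs_mult field_simps)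
  qed
  then have eq: "{\<alpha>. \<alpha> > 0 \<and> x /\<^sub>R \<alpha> \<in> polar A} = {\<alpha>. \<alpha> > 0 \<and> support_fun A x \<le> \<alpha>}"
    by blast
  show ?thesis
  proof (cases "x = 0")
    case True
    then have "{\<alpha>. \<alpha> > 0 \<and> support_fun A x \<le> \<alpha>} = {0<..}"
      using support_fun_0[OF A'(1)] by auto
    then show ?thesis unfolding gauge_norm_def eq using True support_fun_0[OF A'(1)] by simp
  next
    case False
    then have "{\<alpha>. \<alpha> > 0 \<and> support_fun A x \<le> \<alpha>} = {support_fun A x..}"
      using figure_balls_support_fun_pos[OF A False] by auto
    then show ?thesis unfolding gauge_norm_def eq by simp
  qed
qed

section \<open>Inherited inequalities and nondegeneracy\<close>

text \<open>Positive homogeneity makes coefficients on the vectors superfluous.\<close>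

definition inherits_bounds :: "'i set \<Rightarrow> ('i \<Rightarrow> (real ^ 'n) set) \<Rightarrow> (real ^ 'n) set \<Rightarrow> bool"
  where "inherits_bounds \<Xi> F A \<longleftrightarrow>
    (\<forall>y xs. (\<forall>\<xi>\<in>\<Xi>. support_fun (F \<xi>) y \<le> (\<Sum>x\<leftarrow>xs. support_fun (F \<xi>) x)) \<longrightarrow>
      support_fun A y \<le> (\<Sum>x\<leftarrow>xs. support_fun A x))"

lemma inherits_boundsD:
  assumes "inherits_bounds \<Xi> F A"
    and "\<And>\<xi>. \<xi> \<in> \<Xi> \<Longrightarrow> support_fun (F \<xi>) y \<le> (\<Sum>x\<leftarrow>xs. support_fun (F \<xi>) x)"
  shows "support_fun A y \<le> (\<Sum>x\<leftarrow>xs. support_fun A x)"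
  using assms unfolding inherits_bounds_def by blast

lemma inherits_boundsI:
  assumes "\<And>y xs. (\<And>\<xi>. \<xi> \<in> \<Xi> \<Longrightarrow> support_fun (F \<xi>) y \<le> (\<Sum>x\<leftarrow>xs. support_fun (F \<xi>) x)) \<Longrightarrow>
    support_fun A y \<le> (\<Sum>x\<leftarrow>xs. support_fun A x)"
  shows "inherits_bounds \<Xi> F A"
  using assms unfolding inherits_bounds_def by blast

text \<open>A real supremum is known to be an upper bound only for a bounded set; this makes the
  supremum in \<open>endo_norm\<close> usable. An inscribed ball of radius \<open>r\<close> gives
  the bound \<open>B / r\<close>.\<close>

lemma bdd_above_gauge_norm:
  assumes A: "A \<in> figure_balls" and T: "bounded T"
  shows "bdd_above (gauge_norm A ` T)"
proof -
  obtain r where r: "0 < r" "cball 0 r \<subseteq> A"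
    using figure_cball_subset[OF figure_ballsD(1)[OF A]] figure_balls_support_fun_pos[OF A] by blast
  obtain B where B: "0 < B" "\<And>x. x \<in> T \<Longrightarrow> norm x \<le> B"
    using T unfolding bounded_pos by blast
  have "gauge_norm A v \<le> B / r" if "v \<in> T" for v
    unfolding gauge_norm_def
  proof (rule cInf_lower)
    have "norm (v /\<^sub>R (B / r)) \<le> r" using B(1) B(2)[OF that] r(1) by (simp add: field_simps)
    then show "B / r \<in> {\<alpha>. \<alpha> > 0 \<and> v /\<^sub>R \<alpha> \<in> A}" using B(1) r by auto
  qed (auto intro: bdd_belowI[of _ 0])
  then show ?thesis by (intro bdd_aboveI2)
qed

text \<open>Every admissible factor for \<open>v\<close> dominates the quotient, hence so does their
  infimum.\<close>

lemma inner_le_gauge_norm: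
  assumes A: "A \<in> figure_balls" and "x \<noteq> 0"
  shows "v \<bullet> x / support_fun A x \<le> gauge_norm A v"
  unfolding gauge_norm_def
proof (rule cInf_greatest)
  obtain r where r: "0 < r" "cball 0 r \<subseteq> A"
    using figure_cball_subset[OF figure_ballsD(1)[OF A]] figure_balls_support_fun_pos[OF A] by blast
  \<comment> \<open>The inscribed ball provides an admissible factor, so the infimum is over a
    nonempty set; the summand 1 keeps the factor positive at \<open>v = 0\<close>.\<close>
  have p: "0 < (norm v + 1) / r" using r(1) by (simp add: add_nonneg_pos)
  have "norm v + 1 > 0" by (simp add: add_nonneg_pos)
  then have "norm (v /\<^sub>R ((norm v + 1) / r)) \<le> r"
    using r(1) by (simp add: divide_simps)
  then have "(norm v + 1) / r \<in> {\<alpha>. \<alpha> > 0 \<and> v /\<^sub>R \<alpha> \<in> A}" using p r(2) by auto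
  then show "{\<alpha>. \<alpha> > 0 \<and> v /\<^sub>R \<alpha> \<in> A} \<noteq> {}" by blast
next
  fix \<alpha> assume \<alpha>: "\<alpha> \<in> {\<alpha>. \<alpha> > 0 \<and> v /\<^sub>R \<alpha> \<in> A}"
  then have "(v /\<^sub>R \<alpha>) \<bullet> x \<le> support_fun A x"
    using figure_ballsD(1)[OF A] by (intro support_fun_upper) auto
  then show "v \<bullet> x / support_fun A x \<le> \<alpha>"
    using \<alpha> figure_balls_support_fun_pos[OF assms] by (simp add: field_simps)
qed

text \<open>Nondegeneracy is applied to the rank-one endomorphism sending \<open>u\<close> to
  \<open>(u \<bullet> y) *\<^sub>R x\<close>. Pairing its values with \<open>x\<close> turns the
  uniform norm bound into a comparison of support functions in the directions \<open>y\<close> and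
  \<open>x\<close>, with one constant for the whole family.\<close>

lemma nondegenerate_support_fun_le:
  assumes nd: "nondegenerate \<Xi> F" and x: "x \<noteq> 0"
  obtains c where "0 \<le> c" "\<And>\<xi>. \<xi> \<in> \<Xi> \<Longrightarrow> support_fun (F \<xi>) y \<le> c * support_fun (F \<xi>) x"
proof -
  define R where "R = (\<lambda>u. (u \<bullet> y) *\<^sub>R x)"
  have "linear R"
    unfolding R_def by (intro linearI) (auto simp: inner_add_left scaleR_add_left)
  then obtain M where M: "\<And>\<xi>. \<xi> \<in> \<Xi> \<Longrightarrow> endo_norm (F \<xi>) R \<le> M"
    using nd unfolding nondegenerate_def bdd_above_def by blast
  have balls: "F \<xi> \<in> figure_balls" if "\<xi> \<in> \<Xi>" for \<xi> using nd that by (auto simp: nondegenerate_def)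
  \<comment> \<open>For an empty family \<open>M\<close> may be negative; the maximum with 0 keeps
    \<open>c\<close> nonnegative. The divisor compensates the pairing of \<open>x\<close> with
    itself.\<close>
  define c where "c = max 0 M / (x \<bullet> x)"
  have "support_fun (F \<xi>) y \<le> c * support_fun (F \<xi>) x" if \<xi>: "\<xi> \<in> \<Xi>" for \<xi>
  proof (rule support_fun_least)
    note S = balls[OF \<xi>]
    have comp: "compact (F \<xi>)" and ne: "F \<xi> \<noteq> {}"
      using figure_ballsD(1)[OF S] by (auto simp: figures_def)
    show "F \<xi> \<noteq> {}" by (rule ne)
    fix u assume u: "u \<in> F \<xi>"
    have "bounded (R ` F \<xi>)"
      using comp \<open>linear R\<close> by (intro compact_imp_bounded compact_continuous_image linear_continuous_on)
        (auto simp: linear_conv_bounded_linear)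
    then have "bdd_above (gauge_norm (F \<xi>) ` R ` F \<xi>)" by (rule bdd_above_gauge_norm[OF S])
    then have "gauge_norm (F \<xi>) (R u) \<le> endo_norm (F \<xi>) R"
      unfolding endo_norm_def using u by (intro cSUP_upper) (auto simp: image_image)
    then have "R u \<bullet> x / support_fun (F \<xi>) x \<le> max 0 M"
      using inner_le_gauge_norm[OF S x, of "R u"] M[OF \<xi>] by linarith
    then have "(u \<bullet> y) * (x \<bullet> x) \<le> max 0 M * support_fun (F \<xi>) x"
      using figure_balls_support_fun_pos[OF S x] by (simp add: R_def divide_simps mult.commute)
    then show "u \<bullet> y \<le> c * support_fun (F \<xi>) x"
      using x by (simp add: c_def pos_le_divide_eq)
  qed
  moreover have "0 \<le> c" by (simp add: c_def)
  ultimately show thesis using that by blast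
qed

text \<open>A symmetric figure that is not a ball has a nonpositive support value in some nonzero
  direction. The one-term inequalities from nondegeneracy propagate this to every direction, so the
  figure is zero.\<close>

lemma inherits_bounds_imp_gauge:
  assumes nd: "nondegenerate \<Xi> F"
    and A: "A \<in> figures" "A = uminus ` A" and b: "inherits_bounds \<Xi> F A"
  shows "A \<in> gauges"
proof (cases "A \<in> figure_balls")
  case True
  then show ?thesis by (simp add: gauges_def)
next
  case False
  then obtain x where x: "x \<noteq> 0" "support_fun A x \<le> 0"
    using figure_ballsI[OF A] by (meson not_less)
  have "support_fun A y \<le> 0" for y
  proof -
    obtain c where c: "0 \<le> c" "\<And>\<xi>. \<xi> \<in> \<Xi> \<Longrightarrow> support_fun (F \<xi>) y \<le> c * support_fun (F \<xi>) x"
      using nondegenerate_support_fun_le[OF nd x(1)] by blast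
    have "F \<xi> \<in> figures" if "\<xi> \<in> \<Xi>" for \<xi>
      using nd that figure_ballsD(1) by (auto simp: nondegenerate_def)
    then have "support_fun A y \<le> (\<Sum>x\<leftarrow>[c *\<^sub>R x]. support_fun A x)"
      using c by (intro inherits_boundsD[OF b]) (simp add: support_fun_scaleR_nonneg)
    also have "\<dots> = c * support_fun A x" using c(1) A(1) by (simp add: support_fun_scaleR_nonneg)
    also have "\<dots> \<le> 0" using c(1) x(2) by (simp add: mult_nonneg_nonpos)
    finally show ?thesis .
  qed
  then have "A \<subseteq> {0}" by (intro support_fun_subset A figures_singleton_0) simp
  then have "A = {0}" using A(1) by (auto simp: figures_def)
  then show ?thesis by (simp add: gauges_def)
qed

section \<open>Stability of inherited inequalities under cone operations and limits\<close>

text \<open>The distance controls support functions at unit vectors only; homogeneity extends the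
  convergence to all vectors.\<close>

lemma limitin_figures_support_fun:
  assumes lim: "limitin figure_topology \<sigma> A sequentially" and \<sigma>: "\<And>n. \<sigma> n \<in> figures"
  shows "(\<lambda>n. support_fun (\<sigma> n) z) \<longlonglongrightarrow> support_fun A z"
proof -
  have A: "A \<in> figures" and d: "(\<lambda>n. figure_dist (\<sigma> n) A) \<longlonglongrightarrow> 0"
    using lim by (auto simp: Metric_space.limitin_metric_dist_null[OF Metric_space_figures])
  show ?thesis
  proof (cases "z = 0")
    case True
    then show ?thesis using A \<sigma> by (simp add: support_fun_0)
  next
    case False
    define u where "u = z /\<^sub>R norm z"
    have u: "norm u = 1" "z = norm z *\<^sub>R u" using False by (simp_all add: u_def)
    have "\<forall>\<^sub>F n in sequentially. norm (support_fun (\<sigma> n) u - support_fun A u) \<le> figure_dist (\<sigma> n) A"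
      using figure_dist_upper[OF \<sigma> A u(1)] by simp
    then have "(\<lambda>n. support_fun (\<sigma> n) u - support_fun A u) \<longlonglongrightarrow> 0"
      by (rule Lim_null_comparison[OF _ d])
    then have "(\<lambda>n. support_fun (\<sigma> n) u) \<longlonglongrightarrow> support_fun A u" by (simp add: LIM_zero_iff)
    then have "(\<lambda>n. norm z * support_fun (\<sigma> n) u) \<longlonglongrightarrow> norm z * support_fun A u"
      by (intro tendsto_intros)
    moreover have "support_fun B z = norm z * support_fun B u" if "B \<in> figures" for B
      using support_fun_scaleR_nonneg[OF that norm_ge_zero, of z u] u(2) by simp
    ultimately show ?thesis using A \<sigma> by simp
  qed
qed

text \<open>This cone is a competitor in the intersection that defines the hull. Nondegeneracy
  serves to show that its members are gauges; the closure properties are checked on support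
  functions.\<close>

lemma closed_upper_cone_inherits_bounds:
  fixes F :: "'i \<Rightarrow> (real ^ 'n) set"
  assumes nd: "nondegenerate \<Xi> F"
  shows "closed_upper_cone {A \<in> figures. A = uminus ` A \<and> inherits_bounds \<Xi> F A}"
    (is "closed_upper_cone ?K")
proof -
  let ?h = support_fun
  have K_iff: "A \<in> ?K \<longleftrightarrow>
    A \<in> figures \<and> (\<forall>z. ?h A (- z) = ?h A z) \<and> inherits_bounds \<Xi> F A" for A
    using symmetric_iff_support_fun[of A] by blast
  have sub: "?K \<subseteq> gauges" using inherits_bounds_imp_gauge[OF nd] by blast
  have "{0} \<in> ?K"
    unfolding K_iff by (intro conjI allI inherits_boundsI) (simp_all add: figures_singleton_0)
  then have ne: "?K \<noteq> {}" by blast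
  have plus: "A + B \<in> ?K" if "A \<in> ?K" "B \<in> ?K" for A B
  proof -
    have f: "A \<in> figures" "B \<in> figures" and i: "inherits_bounds \<Xi> F A" "inherits_bounds \<Xi> F B"
      using that by blast+
    have "inherits_bounds \<Xi> F (A + B)"
    proof (rule inherits_boundsI)
      fix y xs assume "\<And>\<xi>. \<xi> \<in> \<Xi> \<Longrightarrow> ?h (F \<xi>) y \<le> (\<Sum>x\<leftarrow>xs. ?h (F \<xi>) x)"
      then have "?h A y \<le> (\<Sum>x\<leftarrow>xs. ?h A x)" "?h B y \<le> (\<Sum>x\<leftarrow>xs. ?h B x)"
        using inherits_boundsD[OF i(1)] inherits_boundsD[OF i(2)] by blast+
      then show "?h (A + B) y \<le> (\<Sum>x\<leftarrow>xs. ?h (A + B) x)"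
        by (simp add: support_fun_plus[OF f] sum_list_addf)
    qed
    then show ?thesis using that figures_plus[OF f] unfolding K_iff by (simp add: support_fun_plus)
  qed
  have scale: "(*\<^sub>R) t ` A \<in> ?K" if "A \<in> ?K" "0 \<le> t" for A t
  proof -
    have f: "A \<in> figures" and i: "inherits_bounds \<Xi> F A" using that by blast+
    have "inherits_bounds \<Xi> F ((*\<^sub>R) t ` A)"
    proof (rule inherits_boundsI)
      fix y xs assume "\<And>\<xi>. \<xi> \<in> \<Xi> \<Longrightarrow> ?h (F \<xi>) y \<le> (\<Sum>x\<leftarrow>xs. ?h (F \<xi>) x)"
      then have "?h A y \<le> (\<Sum>x\<leftarrow>xs. ?h A x)" using inherits_boundsD[OF i] by blast
      then show "?h ((*\<^sub>R) t ` A) y \<le> (\<Sum>x\<leftarrow>xs. ?h ((*\<^sub>R) t ` A) x)"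
        using that(2) by (simp add: support_fun_dilate[OF f] sum_list_const_mult mult_left_mono)
    qed
    then show ?thesis using that figures_scaleR[OF f] unfolding K_iff by (simp add: support_fun_dilate)
  qed
  have join: "figure_Join {A, B} \<in> ?K" if "A \<in> ?K" "B \<in> ?K" for A B
  proof -
    have f: "A \<in> figures" "B \<in> figures" and i: "inherits_bounds \<Xi> F A" "inherits_bounds \<Xi> F B"
      using that by blast+
    have "inherits_bounds \<Xi> F (figure_Join {A, B})"
    proof (rule inherits_boundsI)
      fix y xs assume "\<And>\<xi>. \<xi> \<in> \<Xi> \<Longrightarrow> ?h (F \<xi>) y \<le> (\<Sum>x\<leftarrow>xs. ?h (F \<xi>) x)"
      then have "?h A y \<le> (\<Sum>x\<leftarrow>xs. ?h A x)" "?h B y \<le> (\<Sum>x\<leftarrow>xs. ?h B x)"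
        using inherits_boundsD[OF i(1)] inherits_boundsD[OF i(2)] by blast+
      \<comment> \<open>Each sum is dominated by the sum of the maxima, and therefore so is the
        larger of the two left-hand sides.\<close>
      moreover have "(\<Sum>x\<leftarrow>xs. ?h A x) \<le> (\<Sum>x\<leftarrow>xs. max (?h A x) (?h B x))"
        "(\<Sum>x\<leftarrow>xs. ?h B x) \<le> (\<Sum>x\<leftarrow>xs. max (?h A x) (?h B x))"
        by (intro sum_list_mono; simp)+
      ultimately show "?h (figure_Join {A, B}) y \<le> (\<Sum>x\<leftarrow>xs. ?h (figure_Join {A, B}) x)"
        by (simp add: support_fun_Join_pair[OF f])
    qed
    then show ?thesis
      using that figures_Join_pair[OF f] unfolding K_iff by (simp add: support_fun_Join_pair)
  qed
  have clo: "closedin figure_topology ?K"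
    unfolding Metric_space.metric_closedin_iff_sequentially_closed[OF Metric_space_figures]
  proof (intro conjI allI impI)
    show "?K \<subseteq> figures" by blast
    fix \<sigma> :: "nat \<Rightarrow> (real ^ 'n) set" and A
    assume "range \<sigma> \<subseteq> ?K \<and> limitin figure_topology \<sigma> A sequentially"
    then have \<sigma>: "\<And>n. \<sigma> n \<in> ?K" and lim: "limitin figure_topology \<sigma> A sequentially" by blast+
    have A: "A \<in> figures"
      using lim by (simp add: Metric_space.limitin_metric_dist_null[OF Metric_space_figures])
    have L: "(\<lambda>n. ?h (\<sigma> n) z) \<longlonglongrightarrow> ?h A z" for z
      using lim \<sigma> by (intro limitin_figures_support_fun) blast+
    have "?h A (- z) = ?h A z" for z
    proof -
      have "(\<lambda>n. ?h (\<sigma> n) (- z)) = (\<lambda>n. ?h (\<sigma> n) z)" using \<sigma> unfolding K_iff by blast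
      then show ?thesis using L[of z] L[of "- z"] LIMSEQ_unique by metis
    qed
    moreover have "inherits_bounds \<Xi> F A"
    proof (rule inherits_boundsI)
      fix y xs assume *: "\<And>\<xi>. \<xi> \<in> \<Xi> \<Longrightarrow> ?h (F \<xi>) y \<le> (\<Sum>x\<leftarrow>xs. ?h (F \<xi>) x)"
      have "(\<lambda>n. \<Sum>x\<leftarrow>xs. ?h (\<sigma> n) x) \<longlonglongrightarrow> (\<Sum>x\<leftarrow>xs. ?h A x)"
        by (induction xs) (auto intro!: tendsto_add L)
      moreover have "?h (\<sigma> n) y \<le> (\<Sum>x\<leftarrow>xs. ?h (\<sigma> n) x)" for n
      proof -
        have "inherits_bounds \<Xi> F (\<sigma> n)" using \<sigma> by blast
        then show ?thesis using * by (rule inherits_boundsD)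
      qed
      ultimately show "?h A y \<le> (\<Sum>x\<leftarrow>xs. ?h A x)"
        using L[of y] by (intro LIMSEQ_le) auto
    qed
    ultimately show "A \<in> ?K" unfolding K_iff using A by blast
  qed
  show ?thesis
    unfolding closed_upper_cone_def
    by (intro conjI ballI allI impI sub ne plus scale join clo)
qed

lemma upper_hull_inherits_bounds:
  assumes "nondegenerate \<Xi> F" "A \<in> upper_hull \<Xi> F"
  shows "inherits_bounds \<Xi> F A"
proof -
  let ?K = "{A \<in> figures. A = uminus ` A \<and> inherits_bounds \<Xi> F A}"
  have "F ` \<Xi> \<subseteq> ?K"
  proof
    fix A assume "A \<in> F ` \<Xi>"
    then obtain \<xi> where \<xi>: "\<xi> \<in> \<Xi>" "A = F \<xi>" by blast
    then have "A \<in> figure_balls" using assms(1) by (simp add: nondegenerate_def)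
    moreover have "inherits_bounds \<Xi> F A" using \<xi> unfolding inherits_bounds_def by blast
    ultimately show "A \<in> ?K" using figure_ballsD by blast
  qed
  then have "upper_hull \<Xi> F \<subseteq> ?K"
    unfolding upper_hull_def using closed_upper_cone_inherits_bounds[OF assms(1)]
    by (intro hull_minimal)
  then show ?thesis using assms(2) by blast
qed

section \<open>Approximation within a closed upper cone\<close>

text \<open>The larger the family, the fewer inequalities it satisfies. Letting \<open>K\<close>
  index itself through \<open>id\<close> frees the approximation argument from the original
  family.\<close>

lemma inherits_bounds_superset:
  assumes "inherits_bounds \<Xi> F A" "F ` \<Xi> \<subseteq> K"
  shows "inherits_bounds K id A"
  using assms unfolding inherits_bounds_def by (metis id_apply image_subset_iff)

text \<open>If no member works, the alternative yields weights under which the errors of every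
  member combine to something nonnegative. As \<open>K\<close> is a cone, the part homogeneous in
  the member is itself nonnegative. This is an inequality valid on \<open>K\<close>, and its
  inheritance by \<open>A\<close> contradicts the margin \<epsilon>.\<close>

lemma closed_upper_cone_approx_at:
  fixes K :: "(real ^ 'n) set set"
  assumes K: "closed_upper_cone K" and A: "A \<in> figures" "inherits_bounds K id A"
    and X: "finite X" and \<epsilon>: "0 < \<epsilon>"
  shows "\<exists>G\<in>K. (\<forall>x\<in>X. support_fun G x \<le> support_fun A x + \<epsilon>) \<and> support_fun A y - \<epsilon> \<le> support_fun G y"
proof (rule ccontr)
  assume contra: "\<not> ?thesis"
  let ?h = support_fun
  have fig: "G \<in> figures" if "G \<in> K" for G
    using K that gauges_subset_figures unfolding closed_upper_cone_def by blast
  have plus: "G + H \<in> K" if "G \<in> K" "H \<in> K" for G H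
    using K that unfolding closed_upper_cone_def by blast
  have scale: "(*\<^sub>R) t ` G \<in> K" if "G \<in> K" "0 \<le> t" for t G
    using K that unfolding closed_upper_cone_def by blast
  obtain G0 where G0: "G0 \<in> K" using K unfolding closed_upper_cone_def by blast
  \<comment> \<open>The index \<open>None\<close> carries the lower bound at \<open>y\<close> and
    \<open>Some x\<close> the upper bound at \<open>x\<close>, so the two stay apart even when
    \<open>y\<close> lies in \<open>X\<close>. In \<phi> a coordinate is negative exactly when its
    bound holds strictly.\<close>
  define I where "I = insert None (Some ` X)"
  define \<phi> where "\<phi> = (\<lambda>G i. case i of None \<Rightarrow> ?h A y - \<epsilon> - ?h G y | Some x \<Rightarrow> ?h G x - (?h A x + \<epsilon>))"
  have "\<exists>w. (\<forall>i\<in>I. 0 \<le> w i) \<and> (\<exists>i\<in>I. 0 < w i) \<and> (\<forall>g\<in>\<phi> ` K. 0 \<le> (\<Sum>i\<in>I. w i * g i))"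
  proof (rule convex_alternative)
    show "finite I" using X by (simp add: I_def)
    show "\<phi> ` K \<noteq> {}" using G0 by blast
    fix g h and t :: real assume "g \<in> \<phi> ` K" "h \<in> \<phi> ` K" and t: "0 \<le> t" "t \<le> 1"
    then obtain G H where GH: "G \<in> K" "H \<in> K" "g = \<phi> G" "h = \<phi> H" by blast
    let ?M = "(*\<^sub>R) (1 - t) ` G + (*\<^sub>R) t ` H"
    have "?M \<in> K" using GH t by (intro plus scale) auto
    moreover have "?h ?M z = (1 - t) * ?h G z + t * ?h H z" for z
      using fig[OF GH(1)] fig[OF GH(2)] t
      by (simp add: support_fun_plus figures_scaleR support_fun_dilate)
    then have "(\<lambda>i. (1 - t) * g i + t * h i) = \<phi> ?M"
      unfolding GH \<phi>_def by (intro ext) (simp add: algebra_simps split: option.split)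
    ultimately show "(\<lambda>i. (1 - t) * g i + t * h i) \<in> \<phi> ` K" by blast
  next
    fix g assume "g \<in> \<phi> ` K"
    then obtain G where G: "G \<in> K" "g = \<phi> G" by blast
    show "\<exists>i\<in>I. 0 \<le> g i"
    proof (rule ccontr)
      assume neg: "\<not> (\<exists>i\<in>I. 0 \<le> g i)"
      then have "\<phi> G None < 0" by (auto simp: I_def G)
      moreover have "\<phi> G (Some x) < 0" if "x \<in> X" for x using neg that by (auto simp: I_def G)
      ultimately show False using contra G(1) by (force simp: \<phi>_def)
    qed
  qed
  then obtain w where w: "\<And>i. i \<in> I \<Longrightarrow> 0 \<le> w i" "\<exists>i\<in>I. 0 < w i"
    "\<And>G. G \<in> K \<Longrightarrow> 0 \<le> (\<Sum>i\<in>I. w i * \<phi> G i)" by blast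
  define l where "l = w None"
  define u where "u = (\<lambda>x. w (Some x))"
  have l0: "0 \<le> l" and u0: "\<And>x. x \<in> X \<Longrightarrow> 0 \<le> u x" using w(1) by (auto simp: l_def u_def I_def)
  \<comment> \<open>Here \<open>c\<close> collects what does not depend on the member, and
    \<open>D\<close> what is homogeneous in it.\<close>
  define c where "c = l * (?h A y - \<epsilon>) - (\<Sum>x\<in>X. u x * (?h A x + \<epsilon>))"
  define D where "D = (\<lambda>G. (\<Sum>x\<in>X. u x * ?h G x) - l * ?h G y)"
  have cD: "0 \<le> c + D G" if "G \<in> K" for G
  proof -
    have "(\<Sum>i\<in>I. w i * \<phi> G i) = l * \<phi> G None + (\<Sum>x\<in>X. u x * \<phi> G (Some x))"
      using X unfolding I_def by (subst sum.insert) (auto simp: sum.reindex l_def u_def)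
    also have "\<dots> = c + D G"
      by (simp add: \<phi>_def c_def D_def right_diff_distrib sum_subtractf)
    finally show ?thesis using w(3)[OF that] by simp
  qed
  \<comment> \<open>Testing all dilates of one member separates the two parts: \<open>t = 0\<close>
    gives \<open>0 \<le> c\<close>, and large \<open>t\<close> gives
    \<open>0 \<le> D G\<close>.\<close>
  have cone: "0 \<le> c + t * D G" if "G \<in> K" "0 \<le> t" for t G
  proof -
    have "D ((*\<^sub>R) t ` G) = t * D G"
      unfolding D_def using fig[OF that(1)] that(2)
      by (simp add: support_fun_dilate sum_distrib_left right_diff_distrib mult.left_commute)
    then show ?thesis using cD[OF scale[OF that]] by simp
  qed
  have c0: "0 \<le> c" using cone[OF G0, of 0] by simp
  have D0: "0 \<le> D G" if "G \<in> K" for G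
  proof (rule ccontr)
    assume neg: "\<not> 0 \<le> D G"
    \<comment> \<open>With this dilation factor the combined value would be -1.\<close>
    then have "(c + 1) / - D G * D G = - (c + 1)" by simp
    moreover have "0 \<le> (c + 1) / - D G" using neg c0 by (intro divide_nonneg_pos) auto
    ultimately show False using cone[OF that, of "(c + 1) / - D G"] by linarith
  qed
  obtain xs where xs: "set xs = X" "distinct xs" using finite_distinct_list[OF X] by blast
  have ls: "(\<Sum>z\<leftarrow>map (\<lambda>x. u x *\<^sub>R x) xs. ?h G z) = (\<Sum>x\<in>X. u x * ?h G x)" if "G \<in> figures" for G
  proof -
    have "(\<Sum>z\<leftarrow>map (\<lambda>x. u x *\<^sub>R x) xs. ?h G z) = (\<Sum>x\<in>X. ?h G (u x *\<^sub>R x))"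
      using xs by (simp add: sum_list_distinct_conv_sum_set comp_def)
    also have "\<dots> = (\<Sum>x\<in>X. u x * ?h G x)"
      using that u0 by (intro sum.cong) (auto simp: support_fun_scaleR_nonneg)
    finally show ?thesis .
  qed
  have "?h A (l *\<^sub>R y) \<le> (\<Sum>z\<leftarrow>map (\<lambda>x. u x *\<^sub>R x) xs. ?h A z)"
  proof (rule inherits_boundsD[OF A(2)])
    fix G assume G: "G \<in> K"
    then show "?h (id G) (l *\<^sub>R y) \<le> (\<Sum>z\<leftarrow>map (\<lambda>x. u x *\<^sub>R x) xs. ?h (id G) z)"
      unfolding id_apply ls[OF fig[OF G]]
      using D0[OF G] fig[OF G] l0 by (simp add: D_def support_fun_scaleR_nonneg)
  qed
  then have "l * ?h A y \<le> (\<Sum>x\<in>X. u x * ?h A x)"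
    unfolding ls[OF A(1)] using A(1) l0 by (simp add: support_fun_scaleR_nonneg)
  \<comment> \<open>Both kinds of bound carry the slack \<epsilon>, so \<open>c\<close> falls short
    of the inherited inequality by \<epsilon> times the total weight.\<close>
  moreover have "c = l * ?h A y - (\<Sum>x\<in>X. u x * ?h A x) - (l + (\<Sum>x\<in>X. u x)) * \<epsilon>"
    by (simp add: c_def distrib_left sum.distrib sum_distrib_right right_diff_distrib left_diff_distrib distrib_right)
  ultimately have "(l + (\<Sum>x\<in>X. u x)) * \<epsilon> \<le> 0" using c0 by linarith
  moreover have "0 < l + (\<Sum>x\<in>X. u x)"
  proof (cases "0 < l")
    case True
    then show ?thesis using u0 by (intro add_pos_nonneg sum_nonneg)
  next
    case False
    then obtain x where "x \<in> X" "0 < u x" using w(2) by (auto simp: I_def l_def u_def)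
    then have "0 < (\<Sum>x\<in>X. u x)" using X u0 by (intro sum_pos2)
    then show ?thesis using l0 by simp
  qed
  ultimately show False using \<epsilon> by (simp add: mult_le_0_iff)
qed

text \<open>Joins take maxima of support functions: upper bounds shared by both members survive,
  while each member contributes its own lower bounds.\<close>

lemma closed_upper_cone_approx_finite:
  assumes K: "closed_upper_cone K" and Y: "finite Y" "Y \<noteq> {}"
    and "\<And>y. y \<in> Y \<Longrightarrow> \<exists>G\<in>K. (\<forall>x\<in>X. support_fun G x \<le> b x) \<and> c y \<le> support_fun G y"
  shows "\<exists>G\<in>K. (\<forall>x\<in>X. support_fun G x \<le> b x) \<and> (\<forall>y\<in>Y. c y \<le> support_fun G y)"
  using Y assms(4)
proof (induction Y rule: finite_ne_induct)
  case (singleton y)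
  then show ?case by auto
next
  case (insert y Y)
  obtain G where G: "G \<in> K" "\<forall>x\<in>X. support_fun G x \<le> b x" "\<forall>y\<in>Y. c y \<le> support_fun G y"
    using insert.IH insert.prems by blast
  obtain H where H: "H \<in> K" "\<forall>x\<in>X. support_fun H x \<le> b x" "c y \<le> support_fun H y"
    using insert.prems by blast
  have f: "G \<in> figures" "H \<in> figures"
    using K G(1) H(1) gauges_subset_figures unfolding closed_upper_cone_def by blast+
  have "figure_Join {G, H} \<in> K" using K G(1) H(1) unfolding closed_upper_cone_def by blast
  then show ?case
    using G(2,3) H(2,3) by (intro bexI[of _ "figure_Join {G, H}"])
      (auto simp: support_fun_Join_pair[OF f] le_max_iff_disj)
qed

text \<open>If \<open>A\<close> were outside the closed set \<open>K\<close>, some metric ball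
  around \<open>A\<close> would miss \<open>K\<close>; a member inside that ball is constructed from
  finitely many directions.\<close>

lemma mem_closed_upper_cone:
  fixes K :: "(real ^ 'n) set set"
  assumes K: "closed_upper_cone K" and A: "A \<in> figures" "inherits_bounds K id A"
  shows "A \<in> K"
proof (rule ccontr)
  let ?h = support_fun
  assume "A \<notin> K"
  moreover have "closedin figure_topology K" using K by (simp add: closed_upper_cone_def)
  ultimately obtain r where r: "0 < r" "disjnt K (Metric_space.mball figures figure_dist A r)"
    using A(1) unfolding Metric_space.closedin_metric[OF Metric_space_figures] by blast
  \<comment> \<open>The final error is at most \<open>3 * \<epsilon>\<close>: one \<epsilon> at a
    net point and one Lipschitz error for each of the two figures. A quarter of \<open>r\<close>
    leaves strict room.\<close>
  define \<epsilon> where "\<epsilon> = r / 4"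
  have \<epsilon>: "0 < \<epsilon>" using r by (simp add: \<epsilon>_def)
  obtain B where B: "0 < B" "\<And>x. x \<in> A \<Longrightarrow> norm x \<le> B"
    using A(1) compact_imp_bounded[of A] unfolding figures_def bounded_pos by blast
  \<comment> \<open>A Lipschitz constant for \<open>A\<close> and for every figure exceeding it by
    at most \<epsilon> in the signed basis directions. It is fixed before the net, whose mesh
    \<open>\<epsilon> / L\<close> depends on it.\<close>
  define L where "L = real DIM(real ^ 'n) * (B + \<epsilon>)"
  have d1: "1 \<le> real DIM(real ^ 'n)" using DIM_positive[where 'a = "real ^ 'n"] by linarith
  have "1 * (B + \<epsilon>) \<le> L" unfolding L_def using d1 B(1) \<epsilon> by (intro mult_right_mono) auto
  then have LB: "B \<le> L" "0 < L" using B(1) \<epsilon> by auto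
  have "0 < \<epsilon> / L" using \<epsilon> LB(2) by simp
  then obtain Z where Z: "finite Z" "Z \<subseteq> sphere (0 :: real ^ 'n) 1"
    "sphere (0 :: real ^ 'n) 1 \<subseteq> (\<Union>x\<in>Z. ball x (\<epsilon> / L))"
    using seq_compact_imp_totally_bounded[of "sphere (0 :: real ^ 'n) 1"]
      compact_sphere compact_eq_seq_compact_metric by blast
  \<comment> \<open>The signed basis vectors join the net so that the approximating member obeys the
    norm bound \<open>L\<close>.\<close>
  define X where "X = Z \<union> Basis \<union> uminus ` Basis"
  have X: "finite X" "X \<noteq> {}" "\<And>x. x \<in> X \<Longrightarrow> norm x = 1"
    using Z(1,2) by (auto simp: X_def)
  have "\<exists>G\<in>K. (\<forall>x\<in>X. ?h G x \<le> ?h A x + \<epsilon>) \<and> (\<forall>x\<in>X. ?h A x - \<epsilon> \<le> ?h G x)"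
    using K X(1,2)
  proof (rule closed_upper_cone_approx_finite)
    show "\<exists>G\<in>K. (\<forall>x\<in>X. ?h G x \<le> ?h A x + \<epsilon>) \<and> ?h A y - \<epsilon> \<le> ?h G y" for y
      by (rule closed_upper_cone_approx_at[OF K A X(1) \<epsilon>])
  qed
  then obtain G where G: "G \<in> K" "\<And>x. x \<in> X \<Longrightarrow> ?h G x \<le> ?h A x + \<epsilon>"
    "\<And>x. x \<in> X \<Longrightarrow> ?h A x - \<epsilon> \<le> ?h G x" by blast
  have fG: "G \<in> figures" using K G(1) gauges_subset_figures unfolding closed_upper_cone_def by blast
  have "?h A x \<le> B" if "norm x = 1" for x
  proof (rule support_fun_least)
    show "A \<noteq> {}" using A(1) by (auto simp: figures_def)
    show "a \<bullet> x \<le> B" if "a \<in> A" for a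
      using norm_cauchy_schwarz[of a x] B(2)[OF that] \<open>norm x = 1\<close> by simp
  qed
  then have "?h G x \<le> B + \<epsilon>" if "x \<in> X" for x using G(2)[OF that] X(3)[OF that] by fastforce
  then have nG: "norm x \<le> L" if "x \<in> G" for x
    unfolding L_def using that by (intro figure_norm_le[OF fG]) (auto simp: X_def)
  have nA: "norm x \<le> L" if "x \<in> A" for x using B(2)[OF that] LB(1) by linarith
  have "figure_dist A G \<le> 3 * \<epsilon>"
  proof (rule figure_dist_least[OF A(1) fG])
    fix z :: "real ^ 'n" assume "norm z = 1"
    then obtain x where x: "x \<in> Z" "dist x z < \<epsilon> / L" using Z(3) by force
    have s: "L * norm (z - x) \<le> \<epsilon>" "L * norm (x - z) \<le> \<epsilon>"
      using x(2) LB(2) by (simp_all add: dist_norm norm_minus_commute field_simps)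
    have "x \<in> X" using x(1) by (simp add: X_def)
    then have "\<bar>?h A x - ?h G x\<bar> \<le> \<epsilon>" using G(2,3)[of x] by (simp add: abs_le_iff)
    then show "\<bar>?h A z - ?h G z\<bar> \<le> 3 * \<epsilon>"
      using support_fun_lipschitz[OF A(1) nA, of z x] support_fun_lipschitz[OF A(1) nA, of x z]
        support_fun_lipschitz[OF fG nG, of z x] support_fun_lipschitz[OF fG nG, of x z] s
      by linarith
  qed
  also have "3 * \<epsilon> < r" using r(1) by (simp add: \<epsilon>_def)
  finally have "G \<in> Metric_space.mball figures figure_dist A r"
    using A(1) fG by (simp add: Metric_space.in_mball[OF Metric_space_figures])
  then show False using r(2) G(1) by (auto simp: disjnt_iff)
qed

lemma mem_upper_hull_iff:
  assumes "nondegenerate \<Xi> F" "A \<in> figures"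
  shows "A \<in> upper_hull \<Xi> F \<longleftrightarrow> inherits_bounds \<Xi> F A"
proof
  assume "A \<in> upper_hull \<Xi> F"
  then show "inherits_bounds \<Xi> F A" by (rule upper_hull_inherits_bounds[OF assms(1)])
next
  assume *: "inherits_bounds \<Xi> F A"
  show "A \<in> upper_hull \<Xi> F"
    unfolding upper_hull_def hull_def
  proof (rule InterI)
    fix K assume "K \<in> {K. closed_upper_cone K \<and> F ` \<Xi> \<subseteq> K}"
    then show "A \<in> K"
      using mem_closed_upper_cone[OF _ assms(2)] inherits_bounds_superset[OF *] by blast
  qed
qed

section \<open>Inequalities as inclusions between scaled balls\<close>

text \<open>A point of the scaled \<open>S\<close> outside the closed convex join is separated from
  it. The normal and the level of the hyperplane amount to an inequality valid on the family;
  inherited by \<open>S\<close>, it puts the point on the wrong side.\<close>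

lemma scaled_subset_figure_Join:
  fixes x :: "nat \<Rightarrow> real ^ 'n"
  assumes F: "\<And>\<xi>. \<xi> \<in> \<Xi> \<Longrightarrow> F \<xi> \<in> figure_balls" and S: "S \<in> figure_balls"
    and b: "inherits_bounds \<Xi> F S" and k: "k \<in> {1..n}" "x k \<noteq> 0"
  shows "(*\<^sub>R) (1 / (\<Sum>k=1..n. support_fun S (x k))) ` S
    \<subseteq> figure_Join ((\<lambda>\<xi>. (*\<^sub>R) (1 / (\<Sum>k=1..n. support_fun (F \<xi>) (x k))) ` F \<xi>) ` \<Xi>)"
    (is "_ \<subseteq> figure_Join ?\<T>")
proof (rule image_subsetI, rule ccontr)
  let ?\<sigma> = "\<lambda>A. \<Sum>k=1..n. support_fun A (x k)"
  have pos: "0 < ?\<sigma> A" if "A \<in> figure_balls" for A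
    using k figure_balls_support_fun_pos[OF that] figure_balls_support_fun_nonneg[OF that]
    by (intro sum_pos2[of _ k]) auto
  fix s assume s: "s \<in> S" and out: "(1 / ?\<sigma> S) *\<^sub>R s \<notin> figure_Join ?\<T>"
  have "convex (figure_Join ?\<T>)" "closed (figure_Join ?\<T>)"
    by (auto simp: figure_Join_def intro: convex_closure)
  from separating_hyperplane_closed_point[OF this out]
  obtain a b where ab: "a \<bullet> ((1 / ?\<sigma> S) *\<^sub>R s) < b" "\<And>v. v \<in> figure_Join ?\<T> \<Longrightarrow> b < a \<bullet> v" by blast
  \<comment> \<open>The separation bounds the join from below; reversing the signs of normal and
    level gives the upper bound suited to support functions.\<close>
  define c where "c = - b"
  have le: "support_fun (F \<xi>) (- a) \<le> c * ?\<sigma> (F \<xi>)" if \<xi>: "\<xi> \<in> \<Xi>" for \<xi>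
  proof (rule support_fun_least)
    show "F \<xi> \<noteq> {}" using figure_ballsD(1)[OF F[OF \<xi>]] by (auto simp: figures_def)
    fix v assume "v \<in> F \<xi>"
    then have "(1 / ?\<sigma> (F \<xi>)) *\<^sub>R v \<in> \<Union>?\<T>" using \<xi> by blast
    then have "(1 / ?\<sigma> (F \<xi>)) *\<^sub>R v \<in> figure_Join ?\<T>"
      unfolding figure_Join_def by (rule subsetD[OF closure_subset subsetD[OF hull_subset]])
    from ab(2)[OF this] show "v \<bullet> - a \<le> c * ?\<sigma> (F \<xi>)"
      using pos[OF F[OF \<xi>]] by (simp add: c_def field_simps inner_commute)
  qed
  \<comment> \<open>An empty family satisfies every inequality, and the one with an empty list would
    force \<open>support_fun S (x k) \<le> 0\<close>.\<close>
  have "\<Xi> \<noteq> {}"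
  proof
    assume "\<Xi> = {}"
    then have "support_fun S (x k) \<le> (\<Sum>z\<leftarrow>[]. support_fun S z)"
      by (intro inherits_boundsD[OF b]) auto
    then show False using figure_balls_support_fun_pos[OF S k(2)] by simp
  qed
  then obtain \<xi> where \<xi>: "\<xi> \<in> \<Xi>" by blast
  \<comment> \<open>Homogeneity absorbs the level into the vectors only if it is
    nonnegative.\<close>
  have "0 \<le> c * ?\<sigma> (F \<xi>)"
    using le[OF \<xi>] figure_balls_support_fun_nonneg[OF F[OF \<xi>], of "- a"] by linarith
  then have c: "0 \<le> c" using pos[OF F[OF \<xi>]] by (simp add: zero_le_mult_iff)
  let ?xs = "map (\<lambda>k. c *\<^sub>R x k) [1..<Suc n]"
  have ls: "(\<Sum>z\<leftarrow>?xs. support_fun A z) = c * ?\<sigma> A" if "A \<in> figure_balls" for A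
  proof -
    have "(\<Sum>z\<leftarrow>?xs. support_fun A z) = (\<Sum>k=1..n. support_fun A (c *\<^sub>R x k))"
      by (simp add: comp_def interv_sum_list_conv_sum_set_nat atLeastLessThanSuc_atLeastAtMost del: upt_Suc)
    then show ?thesis
      using figure_ballsD(1)[OF that] c by (simp add: support_fun_scaleR_nonneg sum_distrib_left)
  qed
  have "support_fun S (- a) \<le> (\<Sum>z\<leftarrow>?xs. support_fun S z)"
    using le by (intro inherits_boundsD[OF b]) (simp only: ls[OF F])
  moreover have "s \<bullet> - a \<le> support_fun S (- a)"
    by (rule support_fun_upper[OF figure_ballsD(1)[OF S] s])
  ultimately have "s \<bullet> - a \<le> c * ?\<sigma> S" by (simp only: ls[OF S])
  then show False using ab(1) pos[OF S] by (simp add: c_def field_simps inner_commute)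
qed

text \<open>The inequality says that each normalised member lies in the half-space
  \<open>{v. y \<bullet> v \<le> 1}\<close>. This is closed and convex, so it contains the join and
  with it the normalised \<open>S\<close>.\<close>

lemma inherits_bounds_if_scaled_subset:
  fixes F :: "'i \<Rightarrow> (real ^ 'n) set"
  assumes F: "\<And>\<xi>. \<xi> \<in> \<Xi> \<Longrightarrow> F \<xi> \<in> figure_balls" and S: "S \<in> figure_balls"
    and sub: "\<And>n (x :: nat \<Rightarrow> real ^ 'n). \<lbrakk>1 \<le> n; \<exists>k\<in>{1..n}. x k \<noteq> 0\<rbrakk> \<Longrightarrow>
      (*\<^sub>R) (1 / (\<Sum>k=1..n. support_fun S (x k))) ` S
      \<subseteq> figure_Join ((\<lambda>\<xi>. (*\<^sub>R) (1 / (\<Sum>k=1..n. support_fun (F \<xi>) (x k))) ` F \<xi>) ` \<Xi>)"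
  shows "inherits_bounds \<Xi> F S"
proof (rule inherits_boundsI)
  fix y xs assume le: "\<And>\<xi>. \<xi> \<in> \<Xi> \<Longrightarrow> support_fun (F \<xi>) y \<le> (\<Sum>x\<leftarrow>xs. support_fun (F \<xi>) x)"
  have ne: "S \<noteq> {}" using figure_ballsD(1)[OF S] by (auto simp: figures_def)
  obtain e :: "real ^ 'n" where "e \<noteq> 0" using vector_choose_size[of 1] by force
  \<comment> \<open>Over an empty family the join is empty, while a dilate of \<open>S\<close> is
    not.\<close>
  then have "\<Xi> \<noteq> {}" using sub[of 1 "\<lambda>_. e"] ne by (auto simp: figure_Join_def)
  then obtain \<xi>0 where \<xi>0: "\<xi>0 \<in> \<Xi>" by blast
  have nonneg: "0 \<le> (\<Sum>x\<leftarrow>xs. support_fun S x)"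
    using figure_balls_support_fun_nonneg[OF S] by (intro sum_list_nonneg) auto
  show "support_fun S y \<le> (\<Sum>x\<leftarrow>xs. support_fun S x)"
  proof (cases "\<forall>x\<in>set xs. x = 0")
    \<comment> \<open>The assumed inclusions exclude vectors that are all zero. Here the inequality
      for one member of the family already forces \<open>y = 0\<close>.\<close>
    case True
    then have eq: "map (support_fun (F \<xi>0)) xs = map (\<lambda>_. 0) xs"
      using support_fun_0[OF figure_ballsD(1)[OF F[OF \<xi>0]]] by (intro map_cong) auto
    have "support_fun (F \<xi>0) y \<le> 0" using le[OF \<xi>0] by (simp only: eq sum_list_0)
    then have "y = 0" using figure_balls_support_fun_pos[OF F[OF \<xi>0], of y] by linarith
    then show ?thesis using nonneg support_fun_0[OF figure_ballsD(1)[OF S]] by simp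
  next
    case False
    define n where "n = length xs"
    \<comment> \<open>The inclusions number the vectors from 1, the list from 0.\<close>
    define x where "x = (\<lambda>k. xs ! (k - 1))"
    have ls: "(\<Sum>k=1..n. support_fun A (x k)) = (\<Sum>x\<leftarrow>xs. support_fun A x)" for A
      unfolding sum_list_sum_nth n_def x_def
      by (rule sum.reindex_bij_witness[of _ Suc "\<lambda>k. k - 1"]) auto
    obtain j where j: "j < n" "xs ! j \<noteq> 0" using False by (auto simp: in_set_conv_nth n_def)
    have ex: "\<exists>k\<in>{1..n}. x k \<noteq> 0" using j by (intro bexI[of _ "Suc j"]) (auto simp: x_def)
    have pos: "0 < (\<Sum>k=1..n. support_fun A (x k))" if "A \<in> figure_balls" for A
      using ex figure_balls_support_fun_pos[OF that] figure_balls_support_fun_nonneg[OF that]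
      by (auto intro!: sum_pos2)
    let ?T = "(\<lambda>\<xi>. (*\<^sub>R) (1 / (\<Sum>k=1..n. support_fun (F \<xi>) (x k))) ` F \<xi>) ` \<Xi>"
    have "\<Union>?T \<subseteq> {v. y \<bullet> v \<le> 1}"
    proof
      fix v assume "v \<in> \<Union>?T"
      then obtain \<xi> f where f: "\<xi> \<in> \<Xi>" "f \<in> F \<xi>"
        "v = (1 / (\<Sum>k=1..n. support_fun (F \<xi>) (x k))) *\<^sub>R f" by blast
      have "f \<bullet> y \<le> (\<Sum>k=1..n. support_fun (F \<xi>) (x k))"
        using support_fun_upper[OF figure_ballsD(1)[OF F[OF f(1)]] f(2), of y] le[OF f(1)]
        unfolding ls by linarith
      then show "v \<in> {v. y \<bullet> v \<le> 1}" using pos[OF F[OF f(1)]] f(3) by (simp add: inner_commute)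
    qed
    then have "figure_Join ?T \<subseteq> {v. y \<bullet> v \<le> 1}"
      unfolding figure_Join_def
      by (intro closure_minimal hull_minimal convex_halfspace_le closed_halfspace_le)
    moreover have "(*\<^sub>R) (1 / (\<Sum>k=1..n. support_fun S (x k))) ` S \<subseteq> figure_Join ?T"
      using j(1) by (intro sub ex) simp
    ultimately have "y \<bullet> ((1 / (\<Sum>k=1..n. support_fun S (x k))) *\<^sub>R s) \<le> 1" if "s \<in> S" for s
      using that by blast
    then have "s \<bullet> y \<le> (\<Sum>x\<leftarrow>xs. support_fun S x)" if "s \<in> S" for s
      using that pos[OF S] unfolding ls by (simp add: inner_commute)
    then show ?thesis using ne by (intro support_fun_least)
  qed
qed

theorem theorem4p1:
  fixes \<Xi> :: "'i set" and F :: "'i \<Rightarrow> (real ^ 'n) set" and S :: "(real ^ 'n) set"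
  assumes "nondegenerate \<Xi> F"
    and "S \<in> gauges" and "S \<noteq> {0}"
  shows "S \<in> upper_hull \<Xi> F \<longleftrightarrow>
    (\<forall>n\<ge>1. \<forall>x :: nat \<Rightarrow> real ^ 'n. (\<exists>k\<in>{1..n}. x k \<noteq> 0) \<longrightarrow>
      (*\<^sub>R) (1 / (\<Sum>k=1..n. gauge_norm (polar S) (x k))) ` S
      \<subseteq> figure_Join ((\<lambda>\<xi>. (*\<^sub>R) (1 / (\<Sum>k=1..n. gauge_norm (polar (F \<xi>)) (x k))) ` F \<xi>) ` \<Xi>))"
proof -
  have F: "F \<xi> \<in> figure_balls" if "\<xi> \<in> \<Xi>" for \<xi>
    using assms(1) that by (simp add: nondegenerate_def)
  have S: "S \<in> figure_balls" using assms(2,3) by (simp add: gauges_def)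
  \<comment> \<open>The polar identity is available for balls only, so it is applied through a
    congruence that keeps the index in \<Xi>.\<close>
  have eq: "(\<lambda>\<xi>. (*\<^sub>R) (1 / (\<Sum>k=1..n. gauge_norm (polar (F \<xi>)) (x k))) ` F \<xi>) ` \<Xi>
    = (\<lambda>\<xi>. (*\<^sub>R) (1 / (\<Sum>k=1..n. support_fun (F \<xi>) (x k))) ` F \<xi>) ` \<Xi>"
    for n :: nat and x :: "nat \<Rightarrow> real ^ 'n"
    by (rule image_cong[OF refl]) (simp only: gauge_norm_polar[OF F])
  show ?thesis
    unfolding mem_upper_hull_iff[OF assms(1) figure_ballsD(1)[OF S]] eq gauge_norm_polar[OF S]
  proof (intro iffI allI impI)
    fix n :: nat and x :: "nat \<Rightarrow> real ^ 'n"
    assume b: "inherits_bounds \<Xi> F S" and "\<exists>k\<in>{1..n}. x k \<noteq> 0"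
    then obtain k where "k \<in> {1..n}" "x k \<noteq> 0" by blast
    then show "(*\<^sub>R) (1 / (\<Sum>k=1..n. support_fun S (x k))) ` S
      \<subseteq> figure_Join ((\<lambda>\<xi>. (*\<^sub>R) (1 / (\<Sum>k=1..n. support_fun (F \<xi>) (x k))) ` F \<xi>) ` \<Xi>)"
      by (intro scaled_subset_figure_Join[where k = k] F S b)
  qed (rule inherits_bounds_if_scaled_subset[OF F S], assumption, blast)
qed

end
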